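(* Let $\sigma>0$. The scalar function $\rho(t,x)$ and the vector-function $\hat u(t,x)=(\hat u_1,\dots,\hat u_n)(t,x)$ defined in the context solve, for $t>0$, $x\in\mathbb{R}^n$, the system $$\frac{\partial\rho}{\partial t}+\operatorname{div}_x(\rho\hat u)=\frac12\sigma^2\sum_{k=1}^n\frac{\partial^2\rho}{\partial x_k^2},$$ $$\frac{\partial(\rho\hat u_i)}{\partial t}+\sum_{k=1}^n\frac{\partial(\rho\,\hat u_i\,\hat u_k)}{\partial x_k}=\frac12\sigma^2\sum_{k=1}^n\frac{\partial^2(\rho\hat u_i)}{\partial x_k^2}-\int_{\mathbb{R}^n}(u_i-\hat u_i)\,\big((u-\hat u),\nabla_xP(t,x,u)\big)\,du,\qquad i=1,\dots,n.$$
   Context: Let $u_0:\mathbb{R}^n\to\mathbb{R}^n$ be of class $C^1(\mathbb{R}^n)\cap C_b(\mathbb{R}^n)$ ($C_b$ = bounded continuous), and let $f_0:\mathbb{R}^n\to[0,\infty)$ be of class $C^1(\mathbb{R}^n)\cap C_b(\mathbb{R}^n)$ with $\int_{\mathbb{R}^n}f_0\,dx=1$. Let $P=P(t,x,u)$ be the solution of the Fokker--Planck equation $$\frac{\partial P}{\partial t}=\Big[-\sum_{k=1}^n u_k\frac{\partial}{\partial x_k}+\frac12\sigma^2\sum_{k=1}^n\frac{\partial^2}{\partial x_k^2}\Big]P,\qquad P(0,x,u)=\delta(u-u_0(x))f_0(x),$$ given explicitly for $t>0$ by $$P(t,x,u)=\frac{1}{(\sqrt{2\pi t}\,\sigma)^n}\int_{\mathbb{R}^n}\delta(u-u_0(s))\,f_0(s)\,e^{-\frac{|u_0(s)t+s-x|^2}{2\sigma^2t}}\,ds,$$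 where $\delta$ is the Dirac measure on $\mathbb{R}^n$. Thus for each $(t,x)$, $P(t,x,u)\,du$ is a measure in $u$, and for continuous $g$ $$\int_{\mathbb{R}^n} g(u)P(t,x,u)\,du=\frac{1}{(\sqrt{2\pi t}\,\sigma)^n}\int_{\mathbb{R}^n} g(u_0(s))f_0(s)\,e^{-\frac{|u_0(s)t+s-x|^2}{2\sigma^2t}}\,ds;$$ integrals against $\nabla_xP(t,x,u)\,du$ are understood in the same way, with the $x$-gradient falling on the exponential (and the coefficients $g$, which may depend on $(t,x)$, not differentiated). Define $$\rho(t,x)=\int_{\mathbb{R}^n}P(t,x,u)\,du,\qquad \hat u(t,x)=\frac{\int_{\mathbb{R}^n}u\,P(t,x,u)\,du}{\int_{\mathbb{R}^n}P(t,x,u)\,du}.$$ $(\cdot,\cdot)$ is the Euclidean inner product. *)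

theory Defs
  imports "HOL-Analysis.Analysis"
begin

definition C1 :: "('a::real_normed_vector \<Rightarrow> 'b::real_normed_vector) \<Rightarrow> bool" where
  "C1 f \<longleftrightarrow> (\<exists>f' :: 'a \<Rightarrow> 'a \<Rightarrow>\<^sub>L 'b.
     (\<forall>x. (f has_derivative blinfun_apply (f' x)) (at x)) \<and> continuous_on UNIV f')"

definition partially_differentiable :: "'n::finite \<Rightarrow> (real^'n \<Rightarrow> real) \<Rightarrow> real^'n \<Rightarrow> bool" where
  "partially_differentiable k f x \<longleftrightarrow> (\<lambda>h::real. f (x + h *\<^sub>R axis k 1)) differentiable (at 0)"

text \<open>As with \<^const>\<open>deriv\<close>, the value of \<open>partial k f x\<close> carries information only
  together with \<open>partially_differentiable k f x\<close>.\<close>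

definition partial :: "'n::finite \<Rightarrow> (real^'n \<Rightarrow> real) \<Rightarrow> real^'n \<Rightarrow> real" where
  "partial k f x = deriv (\<lambda>h::real. f (x + h *\<^sub>R axis k 1)) 0"

definition gradient :: "(real^'n::finite \<Rightarrow> real) \<Rightarrow> real^'n \<Rightarrow> real^'n" where
  "gradient f x = (\<chi> k. partial k f x)"

definition divergence :: "(real^'n::finite \<Rightarrow> real^'n) \<Rightarrow> real^'n \<Rightarrow> real" where
  "divergence F x = (\<Sum>k\<in>UNIV. partial k (\<lambda>y. F y $ k) x)"

definition kernel ::
    "real \<Rightarrow> (real^'n::finite \<Rightarrow> real^'n) \<Rightarrow> real \<Rightarrow> real^'n \<Rightarrow> real^'n \<Rightarrow> real" where
  "kernel \<sigma> u0 t s x =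
     1 / (sqrt (2 * pi * t) * \<sigma>) ^ CARD('n)
       * exp (- (norm (t *\<^sub>R u0 s + s - x))\<^sup>2 / (2 * \<sigma>\<^sup>2 * t))"

text \<open>The measure \<open>P(t,x,u) du\<close>: integrating the Dirac masses at \<open>u0 s\<close> against the weight
  \<open>f0 s * kernel \<sigma> u0 t s x\<close> over \<open>s\<close> is the push-forward of this weight under \<open>u0\<close>.\<close>

definition FP_measure ::
    "real \<Rightarrow> (real^'n::finite \<Rightarrow> real^'n) \<Rightarrow> (real^'n \<Rightarrow> real) \<Rightarrow> real \<Rightarrow> real^'n \<Rightarrow> (real^'n) measure" where
  "FP_measure \<sigma> u0 f0 t x =
     distr (density lborel (\<lambda>s. ennreal (f0 s * kernel \<sigma> u0 t s x))) borel u0"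

lemma integral_FP_measure:
  fixes g :: "real^'n::finite \<Rightarrow> 'b::{banach, second_countable_topology}"
  assumes "\<sigma> > 0" "t > 0" "continuous_on UNIV u0" "continuous_on UNIV f0" "\<And>s. f0 s \<ge> 0"
    and "continuous_on UNIV g"
  shows "(LINT u|FP_measure \<sigma> u0 f0 t x. g u)
       = (LINT s|lborel. (f0 s * kernel \<sigma> u0 t s x) *\<^sub>R g (u0 s))"
proof -
  have [measurable]: "u0 \<in> borel_measurable borel" "f0 \<in> borel_measurable borel"
      "g \<in> borel_measurable borel"
    using assms by (auto intro: borel_measurable_continuous_onI)
  have [measurable]: "(\<lambda>s. kernel \<sigma> u0 t s x) \<in> borel_measurable borel"
    unfolding kernel_def by measurable
  have "f0 s * kernel \<sigma> u0 t s x \<ge> 0" for s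
    using assms by (simp add: kernel_def)
  then show ?thesis
    unfolding FP_measure_def by (simp add: integral_distr integral_density)
qed

text \<open>The integral of \<open>(G(u), \<nabla>\<^sub>x P(t,x,u))\<close> over \<open>u\<close>: the gradient of the measure falls on
  the kernel only. The field \<open>G\<close> is a function of \<open>u\<close> alone, so when it is instantiated with an
  expression involving \<open>t\<close> and \<open>x\<close>, that expression is not differentiated.\<close>

definition FP_gradient_integral ::
    "real \<Rightarrow> (real^'n::finite \<Rightarrow> real^'n) \<Rightarrow> (real^'n \<Rightarrow> real) \<Rightarrow> real \<Rightarrow> real^'n
      \<Rightarrow> (real^'n \<Rightarrow> real^'n) \<Rightarrow> real" where
  "FP_gradient_integral \<sigma> u0 f0 t x G =
     (LINT s|lborel. f0 s * (G (u0 s) \<bullet> gradient (kernel \<sigma> u0 t s) x))"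

definition rho ::
    "real \<Rightarrow> (real^'n::finite \<Rightarrow> real^'n) \<Rightarrow> (real^'n \<Rightarrow> real) \<Rightarrow> real \<Rightarrow> real^'n \<Rightarrow> real" where
  "rho \<sigma> u0 f0 t x = (LINT u|FP_measure \<sigma> u0 f0 t x. 1)"

definition u_hat ::
    "real \<Rightarrow> (real^'n::finite \<Rightarrow> real^'n) \<Rightarrow> (real^'n \<Rightarrow> real) \<Rightarrow> real \<Rightarrow> real^'n \<Rightarrow> real^'n" where
  "u_hat \<sigma> u0 f0 t x =
     (LINT u|FP_measure \<sigma> u0 f0 t x. u) /\<^sub>R (LINT u|FP_measure \<sigma> u0 f0 t x. 1)"

text \<open>Solutions are classical: every derivative occurring in the system exists for \<open>t > 0\<close> and
  all \<open>x\<close>. The two predicates below collect these existence requirements, for terms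
  differentiated once in \<open>t\<close> and for terms differentiated twice in each \<open>x\<^sub>k\<close>.\<close>

definition time_differentiable :: "(real \<Rightarrow> real^'n::finite \<Rightarrow> real) \<Rightarrow> bool" where
  "time_differentiable w \<longleftrightarrow> (\<forall>t>0. \<forall>x. (\<lambda>\<tau>. w \<tau> x) differentiable (at t))"

definition space_twice_differentiable :: "(real \<Rightarrow> real^'n::finite \<Rightarrow> real) \<Rightarrow> bool" where
  "space_twice_differentiable w \<longleftrightarrow> (\<forall>t>0. \<forall>x k.
     partially_differentiable k (w t) x \<and> partially_differentiable k (partial k (w t)) x)"

end

theory Submission
  imports Defs
begin

text \<open>
  For fixed \<open>s\<close> the kernel is the heat kernel with variance \<open>\<sigma>\<^sup>2 * t\<close>, carried along by the constant
  velocity \<open>u0 s\<close>. It therefore solves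
  \<open>\<partial>\<^sub>t K = \<sigma>\<^sup>2/2 * \<Delta>K - u0 s \<bullet> \<nabla>K\<close> (\<open>has_derivative_kernel_time\<close>). Integrating against a weight
  \<open>w\<close> gives for the moment \<open>m\<^sub>w = \<integral> w * K\<close> the equation
  \<open>\<partial>\<^sub>t m\<^sub>w = \<sigma>\<^sup>2/2 * \<Delta>m\<^sub>w - (\<Sum>k. \<partial>\<^sub>k \<integral> w * u0\<^sub>k * K)\<close> (\<open>has_derivative_moment_time\<close>).

  Taking \<open>w = f0\<close> yields the density equation, since \<open>\<integral> f0 * u0\<^sub>k * K = \<rho> * v\<^sub>k\<close>. Taking
  \<open>w = f0 * u0\<^sub>i\<close> yields an equation for \<open>\<rho> * v\<^sub>i\<close> whose drift term contains the second moments
  \<open>M\<^sub>i\<^sub>k = \<integral> f0 * u0\<^sub>i * u0\<^sub>k * K\<close> in place of \<open>\<rho> * v\<^sub>i * v\<^sub>k\<close>. The gradient integral is exactly the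
  difference: expanding the product \<open>(u\<^sub>i - v\<^sub>i) * (u\<^sub>k - v\<^sub>k)\<close> gives
  \<open>\<partial>\<^sub>k M\<^sub>i\<^sub>k - v\<^sub>k * \<partial>\<^sub>k (\<rho> * v\<^sub>i) - v\<^sub>i * \<partial>\<^sub>k (\<rho> * v\<^sub>k) + v\<^sub>i * v\<^sub>k * \<partial>\<^sub>k \<rho>\<close>, and by the quotient rule
  the last three terms are \<open>- \<partial>\<^sub>k (\<rho> * v\<^sub>i * v\<^sub>k)\<close>
  (\<open>FP_gradient_integral_moments\<close>, \<open>has_partial_product_quotient\<close>).

  Analytically, all derivatives pass under the integral sign: they are the kernel times a
  polynomial of degree at most two in the displacement, hence bounded uniformly in \<open>s\<close> and \<open>x\<close>
  and locally uniformly in \<open>t > 0\<close> (\<open>kernel_derivatives_bounded\<close>), while the weights are integrable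
  because \<open>f0\<close> is and \<open>u0\<close> is bounded. Division by \<open>\<rho>\<close> is harmless because the kernel is positive
  and \<open>f0\<close> has integral \<open>1\<close> (\<open>integral_pos_of_pos_factor\<close>).
\<close>

section \<open>Differentiation under the integral sign\<close>

text \<open>By the mean value theorem the difference quotients are dominated by any function that
  dominates the derivative near \<open>a\<close>, so dominated convergence applies along every sequence that
  tends to \<open>a\<close>.\<close>

lemma has_real_derivative_integral_dominated:
  fixes F F' :: "real \<Rightarrow> 'a \<Rightarrow> real"
  assumes "\<delta> > 0"
    and int: "\<And>h. h \<in> ball a \<delta> \<Longrightarrow> integrable M (F h)"
    and der: "\<And>h s. h \<in> ball a \<delta> \<Longrightarrow> s \<in> space M \<Longrightarrow>
                ((\<lambda>h. F h s) has_real_derivative F' h s) (at h)"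
    and dom: "\<And>h s. h \<in> ball a \<delta> \<Longrightarrow> s \<in> space M \<Longrightarrow> \<bar>F' h s\<bar> \<le> D s"
    and "integrable M D"
    and meas: "F' a \<in> borel_measurable M"
  shows "((\<lambda>h. LINT s|M. F h s) has_real_derivative (LINT s|M. F' a s)) (at a)"
  unfolding has_field_derivative_iff tendsto_at_iff_sequentially
proof (intro allI impI)
  fix X :: "nat \<Rightarrow> real"
  assume X: "\<forall>i. X i \<in> UNIV - {a}" and lim: "X \<longlonglongrightarrow> a"
  obtain N where N: "\<And>i. i \<ge> N \<Longrightarrow> X i \<in> ball a \<delta>"
    using lim \<open>\<delta> > 0\<close> unfolding LIMSEQ_def by (metis dist_commute mem_ball)
  \<comment> \<open>Dropping finitely many terms keeps the whole sequence inside the ball where the hypotheses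
    hold.\<close>
  define Y where "Y i = X (i + N)" for i
  have Y: "Y i \<in> ball a \<delta>" "Y i \<noteq> a" for i
    using N X by (auto simp: Y_def)
  have a: "a \<in> ball a \<delta>"
    using \<open>\<delta> > 0\<close> by simp
  have Ylim: "Y \<longlonglongrightarrow> a"
    unfolding Y_def using lim by (rule LIMSEQ_ignore_initial_segment)
  have "(\<lambda>i. LINT s|M. (F (Y i) s - F a s) / (Y i - a)) \<longlonglongrightarrow> (LINT s|M. F' a s)"
  proof (rule integral_dominated_convergence[where w = D])
    show "F' a \<in> borel_measurable M" "integrable M D" by fact+
    show "(\<lambda>s. (F (Y i) s - F a s) / (Y i - a)) \<in> borel_measurable M" for i
      using int[OF Y(1)[of i]] int[OF a] by auto
    show "AE s in M. (\<lambda>i. (F (Y i) s - F a s) / (Y i - a)) \<longlonglongrightarrow> F' a s"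
    proof (rule AE_I2)
      fix s assume "s \<in> space M"
      from der[OF a this] Ylim Y(2)
      show "(\<lambda>i. (F (Y i) s - F a s) / (Y i - a)) \<longlonglongrightarrow> F' a s"
        unfolding has_field_derivative_iff tendsto_at_iff_sequentially
        by (auto simp: o_def)
    qed
    show "AE s in M. norm ((F (Y i) s - F a s) / (Y i - a)) \<le> D s" for i
    proof (rule AE_I2)
      fix s assume s: "s \<in> space M"
      have "norm (F (Y i) s - F a s) \<le> D s * norm (Y i - a)"
        by (rule field_differentiable_bound[where S = "ball a \<delta>" and f' = "\<lambda>h. F' h s"])
           (use der dom s Y a in \<open>auto intro: has_field_derivative_at_within\<close>)
      then show "norm ((F (Y i) s - F a s) / (Y i - a)) \<le> D s"
        using Y(2)[of i] by (simp add: divide_le_eq abs_divide)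
    qed
  qed
  also have "(\<lambda>i. LINT s|M. (F (Y i) s - F a s) / (Y i - a))
           = (\<lambda>i. ((LINT s|M. F (Y i) s) - (LINT s|M. F a s)) / (Y i - a))"
    using int[OF Y(1)] int[OF a] by (simp add: Bochner_Integration.integral_diff)
  finally have "(\<lambda>i. ((\<lambda>h. ((LINT s|M. F h s) - (LINT s|M. F a s)) / (h - a)) \<circ> X) (i + N))
      \<longlonglongrightarrow> (LINT s|M. F' a s)"
    by (simp add: Y_def o_def)
  then show "((\<lambda>h. ((LINT s|M. F h s) - (LINT s|M. F a s)) / (h - a)) \<circ> X)
      \<longlonglongrightarrow> (LINT s|M. F' a s)"
    by (rule LIMSEQ_offset)
qed

lemma integrable_mult_bounded:
  fixes w \<phi> :: "'a \<Rightarrow> real"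
  assumes "integrable M w" "\<phi> \<in> borel_measurable M" "\<And>s. \<bar>\<phi> s\<bar> \<le> C"
  shows "integrable M (\<lambda>s. w s * \<phi> s)"
proof (rule Bochner_Integration.integrable_bound)
  show "integrable M (\<lambda>s. C * w s)" using assms by simp
  have "\<bar>w s\<bar> * \<bar>\<phi> s\<bar> \<le> \<bar>C\<bar> * \<bar>w s\<bar>" for s
    using mult_right_mono[of "\<bar>\<phi> s\<bar>" "\<bar>C\<bar>" "\<bar>w s\<bar>"] assms(3)[of s] by (simp add: mult.commute)
  then show "AE s in M. norm (w s * \<phi> s) \<le> norm (C * w s)"
    by (simp add: abs_mult)
qed (use assms in simp)

text \<open>The form used below: the weight carries the integrability and does not depend on the
  parameter, while the remaining factor and its derivative only have to be bounded.\<close>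

lemma has_real_derivative_integral_mult:
  fixes \<Phi> \<Phi>' :: "real \<Rightarrow> 'a \<Rightarrow> real"
  assumes w: "integrable M w" and "\<delta> > 0"
    and meas: "\<And>h. \<Phi> h \<in> borel_measurable M" "\<And>h. \<Phi>' h \<in> borel_measurable M"
    and der: "\<And>h s. h \<in> ball a \<delta> \<Longrightarrow> ((\<lambda>h. \<Phi> h s) has_real_derivative \<Phi>' h s) (at h)"
    and bd: "\<And>h s. h \<in> ball a \<delta> \<Longrightarrow> \<bar>\<Phi> h s\<bar> \<le> B" "\<And>h s. h \<in> ball a \<delta> \<Longrightarrow> \<bar>\<Phi>' h s\<bar> \<le> C"
  shows "((\<lambda>h. LINT s|M. w s * \<Phi> h s) has_real_derivative (LINT s|M. w s * \<Phi>' a s)) (at a)"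
proof (rule has_real_derivative_integral_dominated[where D = "\<lambda>s. C * \<bar>w s\<bar>" and \<delta> = \<delta>])
  show "integrable M (\<lambda>s. w s * \<Phi> h s)" if "h \<in> ball a \<delta>" for h
    using w meas(1) bd(1)[OF that] by (rule integrable_mult_bounded)
  show "((\<lambda>h. w s * \<Phi> h s) has_real_derivative w s * \<Phi>' h s) (at h)" if "h \<in> ball a \<delta>" for h s
    using der[OF that] by (rule DERIV_cmult)
  show "\<bar>w s * \<Phi>' h s\<bar> \<le> C * \<bar>w s\<bar>" if "h \<in> ball a \<delta>" for h s
    using mult_right_mono[OF bd(2)[OF that, of s] abs_ge_zero[of "w s"]] by (simp add: abs_mult mult.commute)
qed (use w \<open>\<delta> > 0\<close> meas in auto)

section \<open>Partial derivatives\<close>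

definition has_partial :: "'n::finite \<Rightarrow> (real^'n \<Rightarrow> real) \<Rightarrow> real \<Rightarrow> real^'n \<Rightarrow> bool" where
  "has_partial k f D x \<longleftrightarrow> ((\<lambda>h. f (x + h *\<^sub>R axis k 1)) has_real_derivative D) (at 0)"

lemma has_partialD:
  assumes "has_partial k f D x"
  shows "partially_differentiable k f x" "partial k f x = D"
  using assms unfolding has_partial_def partially_differentiable_def partial_def
  by (auto intro: DERIV_imp_deriv simp: real_differentiable_def)

section \<open>Derivatives of the kernel\<close>

text \<open>At time \<open>t\<close>, a particle that leaves \<open>s\<close> with the constant velocity \<open>u0 s\<close> and diffuses is
  distributed normally around \<open>s + t *\<^sub>R u0 s\<close>; the displacement of this mean from \<open>x\<close> is the
  argument of the Gaussian, and all derivatives of the kernel are the kernel times a polynomial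
  in it, with coefficients that depend on \<open>t\<close> and \<open>u0 s\<close>.\<close>

definition displacement :: "(real^'n \<Rightarrow> real^'n) \<Rightarrow> real \<Rightarrow> real^'n \<Rightarrow> real^'n \<Rightarrow> real^'n::finite" where
  "displacement u0 t s x = t *\<^sub>R u0 s + s - x"

definition kernel_dx ::
    "real \<Rightarrow> (real^'n::finite \<Rightarrow> real^'n) \<Rightarrow> 'n \<Rightarrow> real \<Rightarrow> real^'n \<Rightarrow> real^'n \<Rightarrow> real" where
  "kernel_dx \<sigma> u0 k t s x = kernel \<sigma> u0 t s x * (displacement u0 t s x $ k / (\<sigma>\<^sup>2 * t))"

definition kernel_dxx ::
    "real \<Rightarrow> (real^'n::finite \<Rightarrow> real^'n) \<Rightarrow> 'n \<Rightarrow> real \<Rightarrow> real^'n \<Rightarrow> real^'n \<Rightarrow> real" where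
  "kernel_dxx \<sigma> u0 k t s x =
     kernel \<sigma> u0 t s x * ((displacement u0 t s x $ k / (\<sigma>\<^sup>2 * t))\<^sup>2 - 1 / (\<sigma>\<^sup>2 * t))"

text \<open>The time derivative is written as the right-hand side of the transport-diffusion equation
  with the constant velocity \<open>u0 s\<close>; that the kernel solves this equation is
  \<open>has_derivative_kernel_time\<close>.\<close>

definition kernel_dt ::
    "real \<Rightarrow> (real^'n::finite \<Rightarrow> real^'n) \<Rightarrow> real \<Rightarrow> real^'n \<Rightarrow> real^'n \<Rightarrow> real" where
  "kernel_dt \<sigma> u0 t s x = 1/2 * \<sigma>\<^sup>2 * (\<Sum>k\<in>UNIV. kernel_dxx \<sigma> u0 k t s x)
     - (\<Sum>k\<in>UNIV. u0 s $ k * kernel_dx \<sigma> u0 k t s x)"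

lemma kernel_displacement:
  fixes x :: "real^'n::finite"
  shows "kernel \<sigma> u0 t s x =
    1 / (sqrt (2 * pi * t) * \<sigma>) ^ CARD('n) * exp (- (norm (displacement u0 t s x))\<^sup>2 / (2 * \<sigma>\<^sup>2 * t))"
  by (simp add: kernel_def displacement_def)

lemma displacement_axis:
  "displacement u0 t s (x + h *\<^sub>R axis k 1) = displacement u0 t s x - h *\<^sub>R axis k 1"
  by (simp add: displacement_def)

lemma has_derivative_kernel_axis:
  fixes x :: "real^'n::finite"
  assumes "\<sigma> > 0" "t > 0"
  shows "((\<lambda>h. kernel \<sigma> u0 t s (x + h *\<^sub>R axis k 1)) has_real_derivative
            kernel_dx \<sigma> u0 k t s (x + h *\<^sub>R axis k 1)) (at h)"
proof -
  let ?z = "displacement u0 t s x"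
  have n: "(norm (?z - h *\<^sub>R axis k 1))\<^sup>2 = (norm ?z)\<^sup>2 - 2 * h * ?z $ k + h\<^sup>2" for h
    unfolding power2_norm_eq_inner
    by (simp add: inner_diff_left inner_diff_right inner_axis inner_axis' inner_axis_axis
          power2_eq_square algebra_simps)
  show ?thesis
    unfolding kernel_dx_def kernel_displacement displacement_axis n
    using assms by (auto intro!: derivative_eq_intros simp: field_simps axis_def)
qed

lemma has_derivative_kernel_dx_axis:
  fixes x :: "real^'n::finite"
  assumes "\<sigma> > 0" "t > 0"
  shows "((\<lambda>h. kernel_dx \<sigma> u0 k t s (x + h *\<^sub>R axis k 1)) has_real_derivative
            kernel_dxx \<sigma> u0 k t s (x + h *\<^sub>R axis k 1)) (at h)"
proof -
  have d: "((\<lambda>h. displacement u0 t s (x + h *\<^sub>R axis k 1) $ k / (\<sigma>\<^sup>2 * t)) has_real_derivative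
      - 1 / (\<sigma>\<^sup>2 * t)) (at h)"
    unfolding displacement_axis using assms
    by (auto intro!: derivative_eq_intros simp: axis_def)
  show ?thesis
    using DERIV_mult[OF has_derivative_kernel_axis[OF assms, of u0 s x k h] d]
    unfolding kernel_dx_def kernel_dxx_def by (simp add: power2_eq_square algebra_simps)
qed

text \<open>Both sides are the kernel times a rational function of \<open>t\<close>. The normalising factor
  contributes \<open>- CARD('n) / (2 * t)\<close>, which matches the constant terms of the second
  derivatives in space. The exponent contributes \<open>(norm z)\<^sup>2 / (2 * \<sigma>\<^sup>2 * t\<^sup>2)\<close>, which matches their
  quadratic terms, and the drift term \<open>- (u0 s \<bullet> z) / (\<sigma>\<^sup>2 * t)\<close>, where \<open>z\<close> is the displacement.\<close>

lemma has_derivative_kernel_time: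
  fixes x :: "real^'n::finite"
  assumes "\<sigma> > 0" "t > 0"
  shows "((\<lambda>t. kernel \<sigma> u0 t s x) has_real_derivative kernel_dt \<sigma> u0 t s x) (at t)"
proof -
  let ?n = "CARD('n)"
  let ?z = "displacement u0 t s x"
  define y where "y = s - x"
  define G where "G \<tau> = 1 / (sqrt (2 * pi * \<tau>) * \<sigma>) ^ ?n" for \<tau>
  define q where "q \<tau> = - (norm (displacement u0 \<tau> s x))\<^sup>2 / (2 * \<sigma>\<^sup>2 * \<tau>)" for \<tau>
  have z: "?z = t *\<^sub>R u0 s + y" by (simp add: displacement_def y_def)
  have G: "(G has_real_derivative - (?n / (2 * t)) * G t) (at t)"
  proof -
    define r where "r \<tau> = sqrt (2 * pi * \<tau>) * \<sigma>" for \<tau>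
    have pos: "2 * pi * t > 0" using assms by simp
    have sq: "sqrt (2 * pi * t) * sqrt (2 * pi * t) = 2 * pi * t" using pos by simp
    have "(r has_real_derivative inverse (sqrt (2 * pi * t)) / 2 * (2 * pi) * \<sigma>) (at t)"
      unfolding r_def using pos by (auto intro!: derivative_eq_intros)
    also have "inverse (sqrt (2 * pi * t)) / 2 * (2 * pi) * \<sigma> = r t / (2 * t)"
      unfolding r_def using sq assms pos by (simp add: field_simps del: real_sqrt_mult_self)
    finally have r: "(r has_real_derivative r t / (2 * t)) (at t)" .
    have "r t > 0" using assms by (simp add: r_def)
    obtain m where m: "?n = Suc m"
      using not0_implies_Suc[of ?n] by auto
    have "((\<lambda>\<tau>. inverse (r \<tau> ^ ?n)) has_real_derivative
        - (inverse (r t ^ ?n) * (real ?n * (r t / (2 * t) * r t ^ (?n - Suc 0))) * inverse (r t ^ ?n))) (at t)"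
      by (rule DERIV_inverse' DERIV_power r)+ (use \<open>r t > 0\<close> in simp)
    moreover have "- (inverse (r t ^ ?n) * (real ?n * (r t / (2 * t) * r t ^ (?n - Suc 0))) * inverse (r t ^ ?n))
        = - (?n / (2 * t)) * inverse (r t ^ ?n)"
      unfolding m using \<open>r t > 0\<close> assms by (simp add: field_simps)
    ultimately show ?thesis
      unfolding G_def r_def[symmetric] inverse_eq_divide by simp
  qed
  have q: "(q has_real_derivative
      (norm ?z)\<^sup>2 / (2 * \<sigma>\<^sup>2 * t\<^sup>2) - (u0 s \<bullet> ?z) / (\<sigma>\<^sup>2 * t)) (at t)"
  proof -
    have n: "(norm (displacement u0 \<tau> s x))\<^sup>2 = \<tau>\<^sup>2 * (u0 s \<bullet> u0 s) + 2 * \<tau> * (u0 s \<bullet> y) + y \<bullet> y" for \<tau>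
    proof -
      have "displacement u0 \<tau> s x = \<tau> *\<^sub>R u0 s + y" by (simp add: displacement_def y_def)
      then show ?thesis
        unfolding power2_norm_eq_inner
        by (simp add: inner_add_left inner_add_right inner_commute power2_eq_square algebra_simps)
    qed
    have i: "u0 s \<bullet> ?z = t * (u0 s \<bullet> u0 s) + u0 s \<bullet> y"
      by (simp add: z inner_add)
    show ?thesis
      unfolding q_def n i
      using assms by (auto intro!: derivative_eq_intros simp: field_simps power2_eq_square)
  qed
  have K: "kernel \<sigma> u0 \<tau> s x = G \<tau> * exp (q \<tau>)" for \<tau>
    by (simp add: kernel_displacement G_def q_def)
  have ss: "(\<Sum>k\<in>UNIV. (?z $ k)\<^sup>2) = (norm ?z)\<^sup>2"
    unfolding power2_norm_eq_inner by (simp add: inner_vec_def power2_eq_square)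
  have "(\<Sum>k\<in>UNIV. kernel_dxx \<sigma> u0 k t s x)
      = kernel \<sigma> u0 t s x * ((norm ?z)\<^sup>2 / (\<sigma>\<^sup>2 * t)\<^sup>2 - ?n / (\<sigma>\<^sup>2 * t))"
    unfolding kernel_dxx_def ss[symmetric]
    by (simp add: sum_distrib_left[symmetric] sum_subtractf power_divide sum_divide_distrib)
  moreover have "(\<Sum>k\<in>UNIV. u0 s $ k * kernel_dx \<sigma> u0 k t s x)
      = kernel \<sigma> u0 t s x * ((u0 s \<bullet> ?z) / (\<sigma>\<^sup>2 * t))"
    unfolding kernel_dx_def inner_vec_def
    by (simp add: sum_distrib_left sum_divide_distrib algebra_simps)
  ultimately have dt: "kernel_dt \<sigma> u0 t s x = kernel \<sigma> u0 t s x *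
      (- (?n / (2 * t)) + ((norm ?z)\<^sup>2 / (2 * \<sigma>\<^sup>2 * t\<^sup>2) - (u0 s \<bullet> ?z) / (\<sigma>\<^sup>2 * t)))"
    unfolding kernel_dt_def using assms by (simp only:) (simp add: field_simps power2_eq_square)
  have "((\<lambda>\<tau>. G \<tau> * exp (q \<tau>)) has_real_derivative kernel_dt \<sigma> u0 t s x) (at t)"
    unfolding dt K using DERIV_mult[OF G DERIV_fun_exp[OF q]] by (simp add: algebra_simps)
  then show ?thesis by (simp add: K)
qed

section \<open>Uniform bounds\<close>

lemma kernel_pos: "\<sigma> > 0 \<Longrightarrow> t > 0 \<Longrightarrow> kernel \<sigma> u0 t s x > 0"
  by (simp add: kernel_def)

text \<open>The normalising factor decreases in \<open>t\<close>, so \<open>A\<close> bounds it; the second bound adds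
  \<open>q * exp (- q) \<le> 1\<close> where \<open>exp (- q)\<close> is the Gaussian factor.\<close>

lemma kernel_bounds:
  fixes u0 :: "real^'n::finite \<Rightarrow> real^'n" and s x :: "real^'n"
  assumes "\<sigma> > 0" "0 < a" "a \<le> t" "t \<le> b"
  defines "A \<equiv> 1 / (sqrt (2 * pi * a) * \<sigma>) ^ CARD('n)"
  shows "kernel \<sigma> u0 t s x \<le> A"
    and "kernel \<sigma> u0 t s x * (norm (displacement u0 t s x))\<^sup>2 \<le> 2 * \<sigma>\<^sup>2 * b * A"
proof -
  let ?q = "(norm (displacement u0 t s x))\<^sup>2 / (2 * \<sigma>\<^sup>2 * t)"
  let ?G = "1 / (sqrt (2 * pi * t) * \<sigma>) ^ CARD('n)"
  have q: "?q \<ge> 0" using assms by simp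
  have G: "0 \<le> ?G" "?G \<le> A"
    unfolding A_def using assms by (auto intro!: divide_left_mono power_mono)
  have K: "kernel \<sigma> u0 t s x = ?G * exp (- ?q)"
    by (simp add: kernel_displacement)
  show 1: "kernel \<sigma> u0 t s x \<le> A"
    unfolding K using mult_mono[OF G(2), of "exp (- ?q)" 1] q G by simp
  have "exp (- ?q) * ?q \<le> 1"
  proof -
    have "?q \<le> exp ?q" using exp_ge_add_one_self[of ?q] by linarith
    then have "exp (- ?q) * ?q \<le> exp (- ?q) * exp ?q" by (rule mult_left_mono) simp
    then show ?thesis by (simp add: exp_minus_inverse mult.commute)
  qed
  moreover have A: "A \<ge> 0" using G by (rule order_trans)
  moreover have "0 \<le> exp (- ?q) * ?q" using q by (intro mult_nonneg_nonneg) auto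
  ultimately have "?G * (exp (- ?q) * ?q) \<le> A * 1"
    by (intro mult_mono G(2))
  then have "kernel \<sigma> u0 t s x * ?q \<le> A"
    by (simp only: K mult.assoc mult_1_right)
  then have "kernel \<sigma> u0 t s x * ?q * (2 * \<sigma>\<^sup>2 * t) \<le> A * (2 * \<sigma>\<^sup>2 * b)"
    using assms(1-4) A by (intro mult_mono) auto
  then show "kernel \<sigma> u0 t s x * (norm (displacement u0 t s x))\<^sup>2 \<le> 2 * \<sigma>\<^sup>2 * b * A"
    using assms by (simp add: mult_ac)
qed

text \<open>A single constant serves for all positions and all times in a compact subinterval of the
  positive half-line, because the polynomial factors are at most quadratic in the displacement
  and the velocities are bounded. This is the uniformity that differentiation under the
  integral needs, in \<open>x\<close> as well as in \<open>t\<close>.\<close>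

lemma kernel_derivatives_bounded:
  fixes u0 :: "real^'n::finite \<Rightarrow> real^'n"
  assumes "\<sigma> > 0" "0 < a" "a \<le> b" "\<And>s. norm (u0 s) \<le> B"
  obtains C where
    "\<And>t s x. a \<le> t \<Longrightarrow> t \<le> b \<Longrightarrow> \<bar>kernel \<sigma> u0 t s x\<bar> \<le> C"
    "\<And>t s x k. a \<le> t \<Longrightarrow> t \<le> b \<Longrightarrow> \<bar>kernel_dx \<sigma> u0 k t s x\<bar> \<le> C"
    "\<And>t s x k. a \<le> t \<Longrightarrow> t \<le> b \<Longrightarrow> \<bar>kernel_dxx \<sigma> u0 k t s x\<bar> \<le> C"
    "\<And>t s x. a \<le> t \<Longrightarrow> t \<le> b \<Longrightarrow> \<bar>kernel_dt \<sigma> u0 t s x\<bar> \<le> C"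
proof -
  define A where "A = 1 / (sqrt (2 * pi * a) * \<sigma>) ^ CARD('n)"
  define C1 where "C1 = (A + 2 * \<sigma>\<^sup>2 * b * A) / (\<sigma>\<^sup>2 * a)"
  define C2 where "C2 = 2 * \<sigma>\<^sup>2 * b * A / (\<sigma>\<^sup>2 * a)\<^sup>2 + A / (\<sigma>\<^sup>2 * a)"
  define C3 where "C3 = 1/2 * \<sigma>\<^sup>2 * (CARD('n) * C2) + CARD('n) * (B * C1)"
  have "A \<ge> 0" using assms by (simp add: A_def)
  have "B \<ge> 0" using assms(4)[of 0] norm_ge_zero by (rule order_trans[rotated])
  have C: "C1 \<ge> 0" "C2 \<ge> 0" "C3 \<ge> 0"
    using assms \<open>A \<ge> 0\<close> \<open>B \<ge> 0\<close> by (auto simp: C1_def C2_def C3_def)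
  have bd: "\<bar>kernel \<sigma> u0 t s x\<bar> \<le> A" "\<bar>kernel_dx \<sigma> u0 k t s x\<bar> \<le> C1"
      "\<bar>kernel_dxx \<sigma> u0 k t s x\<bar> \<le> C2" "\<bar>kernel_dt \<sigma> u0 t s x\<bar> \<le> C3"
    if t: "a \<le> t" "t \<le> b" for t s x k
  proof -
    from t have "t > 0" using assms by simp
    let ?K = "kernel \<sigma> u0 t s x"
    let ?z = "displacement u0 t s x"
    have K: "?K > 0" using kernel_pos assms(1) \<open>t > 0\<close> .
    note bd = kernel_bounds[OF assms(1,2) t, of u0 s x, folded A_def]
    have le: "\<sigma>\<^sup>2 * a \<le> \<sigma>\<^sup>2 * t" "0 < \<sigma>\<^sup>2 * a" using t assms by auto
    show "\<bar>?K\<bar> \<le> A" using bd K by simp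
    have zk: "\<bar>?z $ k\<bar> \<le> norm ?z" for k by (rule component_le_norm_cart)
    have zk2: "(?z $ k)\<^sup>2 \<le> (norm ?z)\<^sup>2" for k using power_mono[OF zk[of k], of 2] by simp
    show dx: "\<bar>kernel_dx \<sigma> u0 k t s x\<bar> \<le> C1" for k
    proof -
      \<comment> \<open>A linear factor is absorbed into the quadratic bound by \<open>2 * r \<le> 1 + r\<^sup>2\<close>.\<close>
      have "\<bar>?z $ k\<bar> \<le> 1 + (norm ?z)\<^sup>2"
        using zk[of k] sum_squares_bound[of 1 "norm ?z"] by (simp add: power2_eq_square)
      then have "?K * \<bar>?z $ k\<bar> \<le> A + 2 * \<sigma>\<^sup>2 * b * A"
        using mult_left_mono[of "\<bar>?z $ k\<bar>" "1 + (norm ?z)\<^sup>2" ?K] K bd by (simp add: distrib_left)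
      then have "?K * \<bar>?z $ k\<bar> / (\<sigma>\<^sup>2 * t) \<le> C1"
        unfolding C1_def using K le assms \<open>A \<ge> 0\<close> by (intro frac_le) auto
      then show ?thesis
        using K \<open>t > 0\<close> by (simp add: kernel_dx_def abs_mult abs_divide)
    qed
    show dxx: "\<bar>kernel_dxx \<sigma> u0 k t s x\<bar> \<le> C2" for k
    proof -
      have "?K * (?z $ k)\<^sup>2 \<le> 2 * \<sigma>\<^sup>2 * b * A"
        using mult_left_mono[OF zk2[of k], of ?K] K bd by linarith
      then have 1: "?K * (?z $ k)\<^sup>2 / (\<sigma>\<^sup>2 * t)\<^sup>2 \<le> 2 * \<sigma>\<^sup>2 * b * A / (\<sigma>\<^sup>2 * a)\<^sup>2"
        using K le assms \<open>A \<ge> 0\<close> by (intro frac_le power_mono) auto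
      have 2: "?K / (\<sigma>\<^sup>2 * t) \<le> A / (\<sigma>\<^sup>2 * a)"
        using K le bd by (intro frac_le) auto
      have 3: "0 \<le> ?K * (?z $ k)\<^sup>2 / (\<sigma>\<^sup>2 * t)\<^sup>2" "0 \<le> ?K / (\<sigma>\<^sup>2 * t)"
        using K \<open>t > 0\<close> by auto
      have "kernel_dxx \<sigma> u0 k t s x = ?K * (?z $ k)\<^sup>2 / (\<sigma>\<^sup>2 * t)\<^sup>2 - ?K / (\<sigma>\<^sup>2 * t)"
        by (simp add: kernel_dxx_def power_divide right_diff_distrib)
      then show ?thesis using 1 2 3 unfolding C2_def by linarith
    qed
    show "\<bar>kernel_dt \<sigma> u0 t s x\<bar> \<le> C3"
    proof -
      have "\<bar>\<Sum>k\<in>UNIV. kernel_dxx \<sigma> u0 k t s x\<bar> \<le> CARD('n) * C2"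
        using sum_norm_bound[of UNIV "\<lambda>k. kernel_dxx \<sigma> u0 k t s x" C2] dxx by simp
      then have 1: "\<bar>1/2 * \<sigma>\<^sup>2 * (\<Sum>k\<in>UNIV. kernel_dxx \<sigma> u0 k t s x)\<bar> \<le> 1/2 * \<sigma>\<^sup>2 * (CARD('n) * C2)"
        by (auto simp: abs_mult intro!: mult_left_mono)
      have "\<bar>u0 s $ k\<bar> \<le> B" for k
        using component_le_norm_cart assms(4) by (rule order_trans)
      then have "\<bar>u0 s $ k * kernel_dx \<sigma> u0 k t s x\<bar> \<le> B * C1" for k
        unfolding abs_mult using dx \<open>B \<ge> 0\<close> by (intro mult_mono) auto
      then have 2: "\<bar>\<Sum>k\<in>UNIV. u0 s $ k * kernel_dx \<sigma> u0 k t s x\<bar> \<le> CARD('n) * (B * C1)"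
        using sum_norm_bound[of UNIV "\<lambda>k. u0 s $ k * kernel_dx \<sigma> u0 k t s x" "B * C1"] by simp
      show ?thesis
        using 1 2 unfolding kernel_dt_def C3_def by linarith
    qed
  qed
  define M where "M = A + C1 + C2 + C3"
  have le: "A \<le> M" "C1 \<le> M" "C2 \<le> M" "C3 \<le> M"
    using C \<open>A \<ge> 0\<close> by (simp_all add: M_def)
  note M = order_trans[OF bd(1) le(1)] order_trans[OF bd(2) le(2)]
    order_trans[OF bd(3) le(3)] order_trans[OF bd(4) le(4)]
  show ?thesis
    by (rule that[of M]) (rule M; assumption)+
qed

lemma kernel_measurable:
  fixes u0 :: "real^'n::finite \<Rightarrow> real^'n"
  assumes "u0 \<in> borel_measurable borel"
  shows "(\<lambda>s. kernel \<sigma> u0 t s x) \<in> borel_measurable lborel"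
    and "(\<lambda>s. kernel_dx \<sigma> u0 k t s x) \<in> borel_measurable lborel"
    and "(\<lambda>s. kernel_dxx \<sigma> u0 k t s x) \<in> borel_measurable lborel"
    and "(\<lambda>s. kernel_dt \<sigma> u0 t s x) \<in> borel_measurable lborel"
proof -
  note [measurable] = assms
  have nth[measurable]: "(\<lambda>v::real^'n. v $ j) \<in> borel_measurable borel" for j
    by (intro borel_measurable_continuous_onI continuous_intros)
  have d[measurable]: "(\<lambda>s. displacement u0 t s x) \<in> borel_measurable borel"
    unfolding displacement_def by measurable
  have 1[measurable]: "(\<lambda>s. kernel \<sigma> u0 t s x) \<in> borel_measurable borel"
    unfolding kernel_displacement by measurable
  have 2[measurable]: "(\<lambda>s. kernel_dx \<sigma> u0 k t s x) \<in> borel_measurable borel" for k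
    unfolding kernel_dx_def by measurable
  have 3[measurable]: "(\<lambda>s. kernel_dxx \<sigma> u0 k t s x) \<in> borel_measurable borel" for k
    unfolding kernel_dxx_def by measurable
  have 4: "(\<lambda>s. kernel_dt \<sigma> u0 t s x) \<in> borel_measurable borel"
    unfolding kernel_dt_def by measurable
  show "(\<lambda>s. kernel \<sigma> u0 t s x) \<in> borel_measurable lborel"
    and "(\<lambda>s. kernel_dx \<sigma> u0 k t s x) \<in> borel_measurable lborel"
    and "(\<lambda>s. kernel_dxx \<sigma> u0 k t s x) \<in> borel_measurable lborel"
    and "(\<lambda>s. kernel_dt \<sigma> u0 t s x) \<in> borel_measurable lborel"
    using 1 2 3 4 by simp_all
qed

section \<open>Moments\<close>

text \<open>With the weight \<open>w s = f0 s * g (u0 s)\<close>, \<open>moment\<close> is the integral of \<open>g\<close> against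
  \<open>P(t,x,u) du\<close>. Working with a general integrable weight treats the density, the momentum and the
  second moments alike.\<close>

definition moment ::
    "real \<Rightarrow> (real^'n::finite \<Rightarrow> real^'n) \<Rightarrow> (real^'n \<Rightarrow> real) \<Rightarrow> real \<Rightarrow> real^'n \<Rightarrow> real" where
  "moment \<sigma> u0 w t x = (LINT s|lborel. w s * kernel \<sigma> u0 t s x)"

definition moment_dx ::
    "real \<Rightarrow> (real^'n::finite \<Rightarrow> real^'n) \<Rightarrow> (real^'n \<Rightarrow> real) \<Rightarrow> 'n \<Rightarrow> real \<Rightarrow> real^'n \<Rightarrow> real" where
  "moment_dx \<sigma> u0 w k t x = (LINT s|lborel. w s * kernel_dx \<sigma> u0 k t s x)"

definition moment_dxx ::
    "real \<Rightarrow> (real^'n::finite \<Rightarrow> real^'n) \<Rightarrow> (real^'n \<Rightarrow> real) \<Rightarrow> 'n \<Rightarrow> real \<Rightarrow> real^'n \<Rightarrow> real" where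
  "moment_dxx \<sigma> u0 w k t x = (LINT s|lborel. w s * kernel_dxx \<sigma> u0 k t s x)"

lemma integrable_kernel:
  fixes u0 :: "real^'n::finite \<Rightarrow> real^'n"
  assumes "\<sigma> > 0" "u0 \<in> borel_measurable borel" "\<And>s. norm (u0 s) \<le> B"
    and "integrable lborel w" "t > 0"
  shows "integrable lborel (\<lambda>s. w s * kernel \<sigma> u0 t s x)"
    and "integrable lborel (\<lambda>s. w s * kernel_dx \<sigma> u0 k t s x)"
    and "integrable lborel (\<lambda>s. w s * kernel_dxx \<sigma> u0 k t s x)"
proof -
  obtain C where C:
    "\<And>\<tau> s x. t \<le> \<tau> \<Longrightarrow> \<tau> \<le> t \<Longrightarrow> \<bar>kernel \<sigma> u0 \<tau> s x\<bar> \<le> C"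
    "\<And>\<tau> s x k. t \<le> \<tau> \<Longrightarrow> \<tau> \<le> t \<Longrightarrow> \<bar>kernel_dx \<sigma> u0 k \<tau> s x\<bar> \<le> C"
    "\<And>\<tau> s x k. t \<le> \<tau> \<Longrightarrow> \<tau> \<le> t \<Longrightarrow> \<bar>kernel_dxx \<sigma> u0 k \<tau> s x\<bar> \<le> C"
    "\<And>\<tau> s x. t \<le> \<tau> \<Longrightarrow> \<tau> \<le> t \<Longrightarrow> \<bar>kernel_dt \<sigma> u0 \<tau> s x\<bar> \<le> C"
    by (rule kernel_derivatives_bounded[of \<sigma> t t u0 B, OF assms(1,5) order_refl assms(3)])
       (rule that, blast+)
  note m = kernel_measurable[OF assms(2)]
  show "integrable lborel (\<lambda>s. w s * kernel \<sigma> u0 t s x)"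
    by (rule integrable_mult_bounded[OF assms(4) m(1) C(1)[OF order_refl order_refl]])
  show "integrable lborel (\<lambda>s. w s * kernel_dx \<sigma> u0 k t s x)"
    by (rule integrable_mult_bounded[OF assms(4) m(2) C(2)[OF order_refl order_refl]])
  show "integrable lborel (\<lambda>s. w s * kernel_dxx \<sigma> u0 k t s x)"
    by (rule integrable_mult_bounded[OF assms(4) m(3) C(3)[OF order_refl order_refl]])
qed

lemma has_partial_moment:
  fixes u0 :: "real^'n::finite \<Rightarrow> real^'n"
  assumes "\<sigma> > 0" "u0 \<in> borel_measurable borel" "\<And>s. norm (u0 s) \<le> B"
    and "integrable lborel w" "t > 0"
  shows "has_partial k (moment \<sigma> u0 w t) (moment_dx \<sigma> u0 w k t x) x"
    and "has_partial k (moment_dx \<sigma> u0 w k t) (moment_dxx \<sigma> u0 w k t x) x"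
proof -
  obtain C where C:
    "\<And>\<tau> s x. t \<le> \<tau> \<Longrightarrow> \<tau> \<le> t \<Longrightarrow> \<bar>kernel \<sigma> u0 \<tau> s x\<bar> \<le> C"
    "\<And>\<tau> s x k. t \<le> \<tau> \<Longrightarrow> \<tau> \<le> t \<Longrightarrow> \<bar>kernel_dx \<sigma> u0 k \<tau> s x\<bar> \<le> C"
    "\<And>\<tau> s x k. t \<le> \<tau> \<Longrightarrow> \<tau> \<le> t \<Longrightarrow> \<bar>kernel_dxx \<sigma> u0 k \<tau> s x\<bar> \<le> C"
    "\<And>\<tau> s x. t \<le> \<tau> \<Longrightarrow> \<tau> \<le> t \<Longrightarrow> \<bar>kernel_dt \<sigma> u0 \<tau> s x\<bar> \<le> C"
    by (rule kernel_derivatives_bounded[of \<sigma> t t u0 B, OF assms(1,5) order_refl assms(3)])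
       (rule that, blast+)
  note m = kernel_measurable[OF assms(2)]
  show "has_partial k (moment \<sigma> u0 w t) (moment_dx \<sigma> u0 w k t x) x"
  proof -
    have "((\<lambda>h. LINT s|lborel. w s * kernel \<sigma> u0 t s (x + h *\<^sub>R axis k 1)) has_real_derivative
        (LINT s|lborel. w s * kernel_dx \<sigma> u0 k t s (x + 0 *\<^sub>R axis k 1))) (at 0)"
      by (rule has_real_derivative_integral_mult[where \<delta> = 1 and B = C and C = C
            and \<Phi> = "\<lambda>h s. kernel \<sigma> u0 t s (x + h *\<^sub>R axis k 1)"
            and \<Phi>' = "\<lambda>h s. kernel_dx \<sigma> u0 k t s (x + h *\<^sub>R axis k 1)"])
         (use assms(4) m C has_derivative_kernel_axis[OF assms(1,5)] in auto)
    then show ?thesis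
      by (simp add: has_partial_def moment_def moment_dx_def)
  qed
  show "has_partial k (moment_dx \<sigma> u0 w k t) (moment_dxx \<sigma> u0 w k t x) x"
  proof -
    have "((\<lambda>h. LINT s|lborel. w s * kernel_dx \<sigma> u0 k t s (x + h *\<^sub>R axis k 1)) has_real_derivative
        (LINT s|lborel. w s * kernel_dxx \<sigma> u0 k t s (x + 0 *\<^sub>R axis k 1))) (at 0)"
      by (rule has_real_derivative_integral_mult[where \<delta> = 1 and B = C and C = C
            and \<Phi> = "\<lambda>h s. kernel_dx \<sigma> u0 k t s (x + h *\<^sub>R axis k 1)"
            and \<Phi>' = "\<lambda>h s. kernel_dxx \<sigma> u0 k t s (x + h *\<^sub>R axis k 1)"])
         (use assms(4) m C has_derivative_kernel_dx_axis[OF assms(1,5)] in auto)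
    then show ?thesis
      by (simp add: has_partial_def moment_dx_def moment_dxx_def)
  qed
qed

lemma integrable_mult_velocity:
  fixes u0 :: "real^'n::finite \<Rightarrow> real^'n"
  assumes "u0 \<in> borel_measurable borel" "\<And>s. norm (u0 s) \<le> B" "integrable lborel w"
  shows "integrable lborel (\<lambda>s. w s * u0 s $ k)"
proof (rule integrable_mult_bounded[OF assms(3)])
  have [measurable]: "(\<lambda>v::real^'n. v $ k) \<in> borel_measurable borel"
    by (intro borel_measurable_continuous_onI continuous_intros)
  show "(\<lambda>s. u0 s $ k) \<in> borel_measurable lborel"
    using assms(1) by simp
  show "\<bar>u0 s $ k\<bar> \<le> B" for s
    using component_le_norm_cart assms(2) by (rule order_trans)
qed

text \<open>The Fokker-Planck equation tested against a function of the velocity: in the drift term the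
  velocity \<open>u0 s\<close> multiplies the weight, so the evolution of each moment involves the moments of
  the next higher order.\<close>

lemma has_derivative_moment_time:
  fixes u0 :: "real^'n::finite \<Rightarrow> real^'n"
  assumes "\<sigma> > 0" "u0 \<in> borel_measurable borel" "\<And>s. norm (u0 s) \<le> B"
    and "integrable lborel w" "t > 0"
  shows "((\<lambda>\<tau>. moment \<sigma> u0 w \<tau> x) has_real_derivative
      1/2 * \<sigma>\<^sup>2 * (\<Sum>k\<in>UNIV. moment_dxx \<sigma> u0 w k t x)
      - (\<Sum>k\<in>UNIV. moment_dx \<sigma> u0 (\<lambda>s. w s * u0 s $ k) k t x)) (at t)"
proof -
  have ab: "0 < t/2" "t/2 \<le> 2*t" using assms by auto
  obtain C where C:
    "\<And>\<tau> s x. t/2 \<le> \<tau> \<Longrightarrow> \<tau> \<le> 2*t \<Longrightarrow> \<bar>kernel \<sigma> u0 \<tau> s x\<bar> \<le> C"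
    "\<And>\<tau> s x k. t/2 \<le> \<tau> \<Longrightarrow> \<tau> \<le> 2*t \<Longrightarrow> \<bar>kernel_dx \<sigma> u0 k \<tau> s x\<bar> \<le> C"
    "\<And>\<tau> s x k. t/2 \<le> \<tau> \<Longrightarrow> \<tau> \<le> 2*t \<Longrightarrow> \<bar>kernel_dxx \<sigma> u0 k \<tau> s x\<bar> \<le> C"
    "\<And>\<tau> s x. t/2 \<le> \<tau> \<Longrightarrow> \<tau> \<le> 2*t \<Longrightarrow> \<bar>kernel_dt \<sigma> u0 \<tau> s x\<bar> \<le> C"
    by (rule kernel_derivatives_bounded[of _ _ _ u0, OF assms(1) ab assms(3)]) (rule that, blast+)
  \<comment> \<open>The radius \<open>t/2\<close> keeps the times away from the singularity at \<open>0\<close>.\<close>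
  have ball: "t/2 \<le> \<tau> \<and> \<tau> \<le> 2*t \<and> \<tau> > 0" if "\<tau> \<in> ball t (t/2)" for \<tau>
    using that by (simp add: dist_real_def abs_if split: if_splits)
  have der: "((\<lambda>\<tau>. kernel \<sigma> u0 \<tau> s x) has_real_derivative kernel_dt \<sigma> u0 \<tau> s x) (at \<tau>)"
    if "\<tau> \<in> ball t (t/2)" for \<tau> s
    using has_derivative_kernel_time[OF assms(1)] ball[OF that] by blast
  note m = kernel_measurable[OF assms(2)]
  note [simp] = integrable_kernel[OF assms(1-3) _ assms(5)] assms(4)
    integrable_mult_velocity[OF assms(2,3,4)]
  have "((\<lambda>\<tau>. moment \<sigma> u0 w \<tau> x) has_real_derivative
      (LINT s|lborel. w s * kernel_dt \<sigma> u0 t s x)) (at t)"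
    unfolding moment_def
  proof (rule has_real_derivative_integral_mult[OF assms(4)])
    show "0 < t/2" by fact
    show "\<bar>kernel \<sigma> u0 \<tau> s x\<bar> \<le> C" "\<bar>kernel_dt \<sigma> u0 \<tau> s x\<bar> \<le> C" if "\<tau> \<in> ball t (t/2)" for \<tau> s
      using C(1,4) ball[OF that] by auto
  qed (fact m(1) m(4) der)+
  also have "(\<lambda>s. w s * kernel_dt \<sigma> u0 t s x) =
      (\<lambda>s. 1/2 * \<sigma>\<^sup>2 * (\<Sum>k\<in>UNIV. w s * kernel_dxx \<sigma> u0 k t s x)
        - (\<Sum>k\<in>UNIV. w s * u0 s $ k * kernel_dx \<sigma> u0 k t s x))"
    by (simp add: kernel_dt_def fun_eq_iff right_diff_distrib sum_distrib_left mult_ac)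
  also have "(LINT s|lborel. \<dots> s) = 1/2 * \<sigma>\<^sup>2 * (\<Sum>k\<in>UNIV. moment_dxx \<sigma> u0 w k t x)
      - (\<Sum>k\<in>UNIV. moment_dx \<sigma> u0 (\<lambda>s. w s * u0 s $ k) k t x)"
    unfolding moment_dx_def moment_dxx_def
    by (subst Bochner_Integration.integral_diff)
       (simp_all add: Bochner_Integration.integral_sum)
  finally show ?thesis .
qed

section \<open>Density, momentum and the gradient integral\<close>

text \<open>If the integral vanished, the product and hence \<open>w\<close> would be zero almost everywhere. With
  \<open>w = f0\<close> and the kernel as second factor this makes the density strictly positive, so that the
  quotient defining the mean velocity is a genuine one.\<close>

lemma integral_pos_of_pos_factor:
  fixes w \<phi> :: "'a \<Rightarrow> real"
  assumes "has_bochner_integral M w 1" "\<And>s. w s \<ge> 0" "\<And>s. \<phi> s > 0"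
    and int: "integrable M (\<lambda>s. w s * \<phi> s)"
  shows "(LINT s|M. w s * \<phi> s) > 0"
proof -
  have nonneg: "0 \<le> w s * \<phi> s" for s
    using assms(2,3)[of s] by simp
  have "(LINT s|M. w s * \<phi> s) \<noteq> 0"
  proof
    assume "(LINT s|M. w s * \<phi> s) = 0"
    then have "AE s in M. w s * \<phi> s = 0"
      using integral_nonneg_eq_0_iff_AE[OF int] nonneg by simp
    then have "AE s in M. w s = 0"
      by eventually_elim (use assms(3) in \<open>simp add: less_imp_neq[symmetric]\<close>)
    then have "(LINT s|M. w s) = 0"
      by (rule integral_eq_zero_AE)
    then show False
      using has_bochner_integral_integral_eq[OF assms(1)] by simp
  qed
  moreover have "(LINT s|M. w s * \<phi> s) \<ge> 0"
    using nonneg by simp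
  ultimately show ?thesis by simp
qed

lemma gradient_kernel:
  assumes "\<sigma> > 0" "t > 0"
  shows "gradient (kernel \<sigma> u0 t s) x $ k = kernel_dx \<sigma> u0 k t s x"
proof -
  have "has_partial k (kernel \<sigma> u0 t s) (kernel_dx \<sigma> u0 k t s x) x"
    using has_derivative_kernel_axis[OF assms, of u0 s x k 0] by (simp add: has_partial_def)
  then show ?thesis
    by (simp add: gradient_def has_partialD)
qed

text \<open>Expanding \<open>(u $ i - c $ i) * (u $ k - c $ k)\<close> turns the central moment of the gradient into
  gradients of ordinary moments. For \<open>c = v t x\<close>, the bracket subtracted here is the derivative of
  the flux \<open>\<rho> * v\<^sub>i * v\<^sub>k\<close>; compare \<open>has_partial_product_quotient\<close>.\<close>

lemma FP_gradient_integral_moments: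
  fixes u0 :: "real^'n::finite \<Rightarrow> real^'n" and c :: "real^'n"
  assumes "\<sigma> > 0" "u0 \<in> borel_measurable borel" "\<And>s. norm (u0 s) \<le> B"
    and "integrable lborel f0" "t > 0"
  shows "FP_gradient_integral \<sigma> u0 f0 t x (\<lambda>u. (u $ i - c $ i) *\<^sub>R (u - c))
    = (\<Sum>k\<in>UNIV. moment_dx \<sigma> u0 (\<lambda>s. f0 s * u0 s $ i * u0 s $ k) k t x
        - (c $ k * moment_dx \<sigma> u0 (\<lambda>s. f0 s * u0 s $ i) k t x
           + c $ i * moment_dx \<sigma> u0 (\<lambda>s. f0 s * u0 s $ k) k t x
           - c $ i * c $ k * moment_dx \<sigma> u0 f0 k t x))"
proof -
  note w = integrable_mult_velocity[OF assms(2,3)]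
  note [simp] = integrable_kernel(2)[OF assms(1-3) _ assms(5)] assms(4)
    w[OF assms(4)] w[OF w[OF assms(4)]]
  have "f0 s * (((u0 s $ i - c $ i) *\<^sub>R (u0 s - c)) \<bullet> gradient (kernel \<sigma> u0 t s) x)
      = (\<Sum>k\<in>UNIV. f0 s * u0 s $ i * u0 s $ k * kernel_dx \<sigma> u0 k t s x
          - (c $ k * (f0 s * u0 s $ i * kernel_dx \<sigma> u0 k t s x)
             + c $ i * (f0 s * u0 s $ k * kernel_dx \<sigma> u0 k t s x)
             - c $ i * c $ k * (f0 s * kernel_dx \<sigma> u0 k t s x)))" for s
    unfolding inner_vec_def gradient_kernel[OF assms(1,5)] sum_distrib_left
    by (rule sum.cong[OF refl]) (simp add: algebra_simps)
  then show ?thesis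
    unfolding FP_gradient_integral_def moment_dx_def
    by (simp add: Bochner_Integration.integral_sum Bochner_Integration.integral_diff
          Bochner_Integration.integral_add)
qed

text \<open>If \<open>p\<close> and \<open>q\<close> are components of the momentum and \<open>r\<close> is the density, then \<open>p * (q / r)\<close> is a
  component of the momentum flux. The quotient rule is arranged so that only the velocities
  \<open>p / r\<close> and \<open>q / r\<close> appear as coefficients.\<close>

lemma has_partial_product_quotient:
  assumes "has_partial k p p' x" "has_partial k q q' x" "has_partial k r r' x" "r x \<noteq> 0"
  shows "has_partial k (\<lambda>y. p y * (q y / r y))
    (q x / r x * p' + p x / r x * q' - p x / r x * (q x / r x) * r') x"
  using assms unfolding has_partial_def
  by (auto intro!: derivative_eq_intros simp: field_simps power2_eq_square)

section \<open>The balance laws for mass and momentum\<close>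

theorem proposition2:
  fixes \<sigma> :: real
    and u0 :: "real^'n::finite \<Rightarrow> real^'n"
    and f0 :: "real^'n \<Rightarrow> real"
    and \<rho> :: "real \<Rightarrow> real^'n \<Rightarrow> real"
    and v :: "real \<Rightarrow> real^'n \<Rightarrow> real^'n"
  assumes "\<sigma> > 0"
    and "C1 u0" and "u0 \<in> bcontfun"
    and "C1 f0" and "f0 \<in> bcontfun"
    and "\<And>x. f0 x \<ge> 0"
    and "has_bochner_integral lborel f0 1"
    and "\<rho> = rho \<sigma> u0 f0"
    and "v = u_hat \<sigma> u0 f0"
  shows
    "time_differentiable \<rho> \<and> space_twice_differentiable \<rho> \<and>
     (\<forall>i. time_differentiable (\<lambda>t x. \<rho> t x * v t x $ i) \<and>
          space_twice_differentiable (\<lambda>t x. \<rho> t x * v t x $ i) \<and>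
          (\<forall>k. \<forall>t>0. \<forall>x. partially_differentiable k (\<lambda>y. \<rho> t y * v t y $ i * v t y $ k) x)) \<and>
     (\<forall>t>0. \<forall>x.
        deriv (\<lambda>\<tau>. \<rho> \<tau> x) t + divergence (\<lambda>y. \<rho> t y *\<^sub>R v t y) x
          = 1/2 * \<sigma>\<^sup>2 * (\<Sum>k\<in>UNIV. partial k (partial k (\<rho> t)) x) \<and>
        (\<forall>i. deriv (\<lambda>\<tau>. \<rho> \<tau> x * v \<tau> x $ i) t
               + (\<Sum>k\<in>UNIV. partial k (\<lambda>y. \<rho> t y * v t y $ i * v t y $ k) x)
             = 1/2 * \<sigma>\<^sup>2 * (\<Sum>k\<in>UNIV. partial k (partial k (\<lambda>y. \<rho> t y * v t y $ i)) x)
               - FP_gradient_integral \<sigma> u0 f0 t x (\<lambda>u. (u $ i - v t x $ i) *\<^sub>R (u - v t x))))"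
proof -
  have u0c: "continuous_on UNIV u0" and f0c: "continuous_on UNIV f0"
    using assms(3,5) by (auto simp: bcontfun_def)
  obtain B where B: "\<And>s. norm (u0 s) \<le> B"
    using assms(3) by (auto simp: bcontfun_def bounded_iff)
  have u0m: "u0 \<in> borel_measurable borel"
    using u0c by (rule borel_measurable_continuous_onI)
  have f0i: "integrable lborel f0"
    using assms(7) by (simp add: has_bochner_integral_iff)
  \<comment> \<open>The density and the components of the momentum, as moments.\<close>
  define r where "r = moment \<sigma> u0 f0"
  define a where "a i = moment \<sigma> u0 (\<lambda>s. f0 s * u0 s $ i)" for i
  note wi = integrable_mult_velocity[OF u0m B f0i]
  note FP = integral_FP_measure[OF assms(1) _ u0c f0c assms(6)]
  note K = integrable_kernel(1)[OF assms(1) u0m B]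
  have rho: "\<rho> t x = r t x" if "t > 0" for t x
    unfolding assms(8) rho_def r_def moment_def using FP[OF that, of "\<lambda>_. 1 :: real" x] by simp
  have rpos: "r t x > 0" if "t > 0" for t x
    unfolding r_def moment_def
    using assms(6,7) kernel_pos[OF assms(1) that] K[OF f0i that]
    by (intro integral_pos_of_pos_factor) auto
  have momentum: "(LINT u|FP_measure \<sigma> u0 f0 t x. u) $ i = a i t x" if "t > 0" for t x i
  proof -
    have "integrable lborel (\<lambda>s. (f0 s * kernel \<sigma> u0 t s x) *\<^sub>R u0 s)"
    proof (rule Bochner_Integration.integrable_bound)
      show "integrable lborel (\<lambda>s. B * (f0 s * kernel \<sigma> u0 t s x))"
        using K[OF f0i that] by simp
      have "\<bar>f0 s * kernel \<sigma> u0 t s x\<bar> * norm (u0 s) \<le> \<bar>B\<bar> * \<bar>f0 s * kernel \<sigma> u0 t s x\<bar>" for s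
        using mult_left_mono[of "norm (u0 s)" "\<bar>B\<bar>" "\<bar>f0 s * kernel \<sigma> u0 t s x\<bar>"] B[of s]
        by (simp add: mult.commute)
      then show "AE s in lborel. norm ((f0 s * kernel \<sigma> u0 t s x) *\<^sub>R u0 s)
          \<le> norm (B * (f0 s * kernel \<sigma> u0 t s x))"
        by (simp add: abs_mult)
      show "(\<lambda>s. (f0 s * kernel \<sigma> u0 t s x) *\<^sub>R u0 s) \<in> borel_measurable lborel"
        using borel_measurable_integrable[OF K[OF f0i that]] u0m
        by (intro borel_measurable_scaleR) auto
    qed
    then have "(LINT s|lborel. ((f0 s * kernel \<sigma> u0 t s x) *\<^sub>R u0 s) \<bullet> axis i 1)
        = (LINT s|lborel. (f0 s * kernel \<sigma> u0 t s x) *\<^sub>R u0 s) \<bullet> axis i 1"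
      by (intro integral_inner_left) auto
    then show ?thesis
      using FP[OF that, of "\<lambda>u. u" x] unfolding a_def moment_def
      by (simp add: inner_axis mult_ac)
  qed
  have v: "v t x $ i = a i t x / r t x" if "t > 0" for t x i
    using momentum[OF that] rho[OF that]
    unfolding assms(8,9) u_hat_def rho_def by (simp add: divide_inverse mult.commute)
  have rv: "\<rho> t x * v t x $ i = a i t x" if "t > 0" for t x i
    using rpos[OF that, of x] by (simp add: rho that v)
  note px = has_partial_moment[OF assms(1) u0m B]
  note dt = has_derivative_moment_time[OF assms(1) u0m B]
  have pr: "has_partial k (r t) (moment_dx \<sigma> u0 f0 k t x) x"
       "has_partial k (partial k (r t)) (moment_dxx \<sigma> u0 f0 k t x) x" if "t > 0" for t x k
  proof -
    show 1: "has_partial k (r t) (moment_dx \<sigma> u0 f0 k t x) x" for x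
      unfolding r_def by (rule px(1)[OF f0i that])
    have "partial k (r t) = moment_dx \<sigma> u0 f0 k t"
      using has_partialD(2)[OF 1] by (rule ext)
    then show "has_partial k (partial k (r t)) (moment_dxx \<sigma> u0 f0 k t x) x"
      using px(2)[OF f0i that] by simp
  qed
  have pa: "has_partial k (a i t) (moment_dx \<sigma> u0 (\<lambda>s. f0 s * u0 s $ i) k t x) x"
       "has_partial k (partial k (a i t)) (moment_dxx \<sigma> u0 (\<lambda>s. f0 s * u0 s $ i) k t x) x"
       if "t > 0" for t x i k
  proof -
    show 1: "has_partial k (a i t) (moment_dx \<sigma> u0 (\<lambda>s. f0 s * u0 s $ i) k t x) x" for x
      unfolding a_def by (rule px(1)[OF wi that])
    have "partial k (a i t) = moment_dx \<sigma> u0 (\<lambda>s. f0 s * u0 s $ i) k t"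
      using has_partialD(2)[OF 1] by (rule ext)
    then show "has_partial k (partial k (a i t)) (moment_dxx \<sigma> u0 (\<lambda>s. f0 s * u0 s $ i) k t x) x"
      using px(2)[OF wi that] by simp
  qed
  have flux: "has_partial k (\<lambda>y. \<rho> t y * v t y $ i * v t y $ k)
      (v t x $ k * moment_dx \<sigma> u0 (\<lambda>s. f0 s * u0 s $ i) k t x
       + v t x $ i * moment_dx \<sigma> u0 (\<lambda>s. f0 s * u0 s $ k) k t x
       - v t x $ i * v t x $ k * moment_dx \<sigma> u0 f0 k t x) x" if "t > 0" for t x i k
    unfolding rv[OF that] unfolding v[OF that]
    by (rule has_partial_product_quotient) (use pa pr rpos[OF that, of x] that in auto)
  \<comment> \<open>The identification of \<open>\<rho>\<close> and \<open>\<rho> * v\<^sub>i\<close> with moments is made at positive times; these form an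
    open set, so it carries over to the derivatives.\<close>
  have tr: "((\<lambda>\<tau>. \<rho> \<tau> x) has_real_derivative
      1/2 * \<sigma>\<^sup>2 * (\<Sum>k\<in>UNIV. moment_dxx \<sigma> u0 f0 k t x)
      - (\<Sum>k\<in>UNIV. moment_dx \<sigma> u0 (\<lambda>s. f0 s * u0 s $ k) k t x)) (at t)" if "t > 0" for t x
    by (rule has_field_derivative_transform_within_open[OF dt[OF f0i that], where S = "{0<..}"])
       (use that rho in \<open>auto simp: r_def\<close>)
  have ta: "((\<lambda>\<tau>. \<rho> \<tau> x * v \<tau> x $ i) has_real_derivative
      1/2 * \<sigma>\<^sup>2 * (\<Sum>k\<in>UNIV. moment_dxx \<sigma> u0 (\<lambda>s. f0 s * u0 s $ i) k t x)
      - (\<Sum>k\<in>UNIV. moment_dx \<sigma> u0 (\<lambda>s. f0 s * u0 s $ i * u0 s $ k) k t x)) (at t)"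
    if "t > 0" for t x i
    by (rule has_field_derivative_transform_within_open[OF dt[OF wi that], where S = "{0<..}"])
       (use that rv in \<open>auto simp: a_def\<close>)
  have rho_fun: "\<rho> t = r t" if "t > 0" for t
    using rho[OF that] by (rule ext)
  note gradint = FP_gradient_integral_moments[OF assms(1) u0m B f0i]
  show ?thesis
  proof (intro conjI allI impI)
    show "time_differentiable \<rho>"
      using tr by (auto simp: time_differentiable_def real_differentiable_def)
    show "space_twice_differentiable \<rho>"
      using has_partialD(1)[OF pr(1)] has_partialD(1)[OF pr(2)]
      by (auto simp: space_twice_differentiable_def rho_fun)
    show "time_differentiable (\<lambda>t x. \<rho> t x * v t x $ i)" for i
      unfolding time_differentiable_def real_differentiable_def using ta by blast
    show "space_twice_differentiable (\<lambda>t x. \<rho> t x * v t x $ i)" for i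
      using has_partialD(1)[OF pa(1)] has_partialD(1)[OF pa(2)]
      by (auto simp: space_twice_differentiable_def rv)
    show "partially_differentiable k (\<lambda>y. \<rho> t y * v t y $ i * v t y $ k) x" if "t > 0" for i k t x
      using has_partialD(1)[OF flux[OF that]] .
    show "deriv (\<lambda>\<tau>. \<rho> \<tau> x) t + divergence (\<lambda>y. \<rho> t y *\<^sub>R v t y) x
          = 1/2 * \<sigma>\<^sup>2 * (\<Sum>k\<in>UNIV. partial k (partial k (\<rho> t)) x)" if t: "t > 0" for t x
      unfolding divergence_def vector_scaleR_component real_scaleR_def rv[OF t]
      unfolding DERIV_imp_deriv[OF tr[OF t]] has_partialD(2)[OF pa(1)[OF t]]
        rho_fun[OF t] has_partialD(2)[OF pr(2)[OF t]]
      by simp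
    show "deriv (\<lambda>\<tau>. \<rho> \<tau> x * v \<tau> x $ i) t
               + (\<Sum>k\<in>UNIV. partial k (\<lambda>y. \<rho> t y * v t y $ i * v t y $ k) x)
             = 1/2 * \<sigma>\<^sup>2 * (\<Sum>k\<in>UNIV. partial k (partial k (\<lambda>y. \<rho> t y * v t y $ i)) x)
               - FP_gradient_integral \<sigma> u0 f0 t x (\<lambda>u. (u $ i - v t x $ i) *\<^sub>R (u - v t x))"
      if t: "t > 0" for t x i
      unfolding DERIV_imp_deriv[OF ta[OF t]] has_partialD(2)[OF flux[OF t]]
      unfolding rv[OF t] has_partialD(2)[OF pa(2)[OF t]] gradint[OF t]
      \<comment> \<open>The derivatives of the flux cancel against those in the gradient integral, which leaves
        the derivatives of the second moments.\<close>
      by (simp add: sum_subtractf sum.distrib)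
  qed
qed

end
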